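(* Let $n \geq 3$. Suppose $(\mu, \Sigma)$ and $(\mu', \Sigma')$ both satisfy the normalization below. Let $X \sim \mathcal{N}(\mu,\Sigma)$ and $X' \sim \mathcal{N}(\mu',\Sigma')$, and suppose that for all pairwise distinct $i,j,k \in [n]$, $$\Pr\{X_i \geq X_j \geq X_k\} = \Pr\{X'_i \geq X'_j \geq X'_k\}.$$ Then $\mu = \mu'$ and $\Sigma = \Sigma'$. In words, $(\mu,\Sigma)$ is uniquely identifiable from the three-way observation probabilities.
   Context: Probit model: utilities $X \sim \mathcal{N}(\mu, \Sigma)$ with $\mu \in \mathbb{R}^n$ and $\Sigma\in\mathbb{R}^{n\times n}$ symmetric positive semidefinite. Normalization: $\langle \mu, \mathbf{1}\rangle = 0$, $\Sigma\mathbf{1} = 0$, $\operatorname{Tr}(\Sigma) = n$, and $\operatorname{rank}(\Sigma) = n-1$. *)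

theory Defs
  imports "HOL-Probability.Probability"
begin

definition std_gaussian :: "(real ^ 'n) measure" where
  "std_gaussian = density lborel (\<lambda>x. ennreal (\<Prod>i\<in>UNIV. std_normal_density (x $ i)))"

text \<open>M is the law of a (possibly degenerate) Gaussian vector N(mu, S):
  the law of mu + A z with z standard Gaussian, where A A^T = S.\<close>
definition is_gaussian_law :: "(real ^ 'n) measure \<Rightarrow> real ^ 'n \<Rightarrow> real ^ 'n ^ 'n \<Rightarrow> bool" where
  "is_gaussian_law M mu S \<longleftrightarrow>
     (\<exists>A :: real ^ 'n ^ 'n. A ** transpose A = S \<and>
        M = distr std_gaussian borel (\<lambda>z. mu + A *v z))"

definition probit_normalized :: "real ^ 'n \<Rightarrow> real ^ 'n ^ 'n \<Rightarrow> bool" where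
  "probit_normalized mu S \<longleftrightarrow>
     transpose S = S \<and>
     (\<forall>x. 0 \<le> x \<bullet> (S *v x)) \<and>
     mu \<bullet> (\<chi> i. 1) = 0 \<and>
     S *v (\<chi> i. 1) = 0 \<and>
     trace S = real CARD('n) \<and>
     rank S = CARD('n) - 1"

end

theory Submission
  imports Defs
begin

text \<open>
  Write \<open>X = \<mu> + A z\<close>; the rows \<open>A\<^sub>i\<close> are affinely independent points with
  \<open>Var (X\<^sub>i - X\<^sub>j) = \<bar>A\<^sub>i - A\<^sub>j\<bar>\<^sup>2\<close>. Ties being null, the three-way probabilities determine
  \<open>Pr (X\<^sub>i \<ge> X\<^sub>j)\<close> and hence the standardized mean of \<open>X\<^sub>i - X\<^sub>j\<close>. Given these, \<open>Pr (X\<^sub>i \<ge> X\<^sub>j \<ge> X\<^sub>k)\<close>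
  is strictly increasing in the correlation of \<open>X\<^sub>i - X\<^sub>j\<close> and \<open>X\<^sub>j - X\<^sub>k\<close>, so all angles of the
  triangles \<open>A\<^sub>i A\<^sub>j A\<^sub>k\<close> are determined. Triangles with equal angles are similar and any two edges
  are linked through triangles, so all distances are determined up to one common factor. As
  \<open>\<Sigma> 1 = 0\<close>, the distances determine \<open>\<Sigma>\<close>; the trace fixes the factor, and then
  \<open>\<langle>\<mu>, 1\<rangle> = 0\<close> fixes \<open>\<mu>\<close>.
\<close>

section \<open>Orthogonal invariance of Lebesgue measure\<close>

lemma continuous_on_orthogonal_transformation:
  fixes f :: "'a::euclidean_space \<Rightarrow> 'a"
  assumes "orthogonal_transformation f"
  shows "continuous_on S f"
  using assms by (intro linear_continuous_on linear_conv_bounded_linear[THEN iffD1] orthogonal_transformation_linear)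

text \<open>An open set is filled up to a null set with disjoint balls, whose volume an isometry preserves.\<close>

lemma emeasure_lborel_orthogonal_vimage_ge:
  fixes f :: "'a::euclidean_space \<Rightarrow> 'a"
  assumes f: "orthogonal_transformation f" and U: "open U"
  shows "emeasure lborel U \<le> emeasure lborel (f -` U)"
proof -
  define K where "K = {(x, r). 0 < r \<and> ball x r \<subseteq> U}"
  \<comment> \<open>Vitali's theorem needs a fine cover: each point of \<open>U\<close> lies in
    balls from \<open>K\<close> of arbitrarily small radius.\<close>
  have "\<exists>i. i \<in> K \<and> x \<in> ball (fst i) (snd i) \<and> snd i < d" if "x \<in> U" "0 < d" for x d
  proof -
    obtain e where "e > 0" "ball x e \<subseteq> U"
      using U \<open>x \<in> U\<close> by (meson openE)
    then have "(x, min e (d / 2)) \<in> K"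
      using \<open>0 < d\<close> by (auto simp: K_def)
    then show ?thesis
      using \<open>e > 0\<close> \<open>0 < d\<close> by (intro exI[of _ "(x, min e (d / 2))"]) auto
  qed
  then obtain C where C: "countable C" "C \<subseteq> K"
      and disj: "pairwise (\<lambda>i j. disjnt (ball (fst i) (snd i)) (ball (fst j) (snd j))) C"
      and neg: "negligible (U - (\<Union>i\<in>C. ball (fst i) (snd i)))"
    by (rule Vitali_covering_theorem_balls[where S = U and K = K and a = fst and r = snd]) blast+
  let ?B = "\<lambda>i. ball (fst i) (snd i)"
  have contf: "continuous_on UNIV f"
    by (rule continuous_on_orthogonal_transformation[OF f])
  have meas [measurable]: "f -` ?B i \<in> sets borel" for i
    using contf by (intro borel_open) (simp add: open_vimage)
  have sub: "(\<Union>i\<in>C. ?B i) \<subseteq> U"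
    using C by (fastforce simp: K_def)
  have ball_eq: "emeasure lborel (?B i) = emeasure lborel (f -` ?B i)" for i
  proof -
    have "f -` ?B i = ball (inv f (fst i)) (snd i)"
      using image_orthogonal_transformation_ball[OF orthogonal_transformation_inv[OF f], of "fst i" "snd i"]
      by (simp add: bij_vimage_eq_inv_image f orthogonal_transformation_bij)
    then show ?thesis
      \<comment> \<open>Here \<open>i\<close> ranges over all pairs; for a negative radius both
        balls are empty.\<close>
      by (cases "snd i \<ge> 0") (auto simp: emeasure_ball ball_empty)
  qed
  have fam: "disjoint_family_on ?B C"
    using disj by (auto simp: disjoint_family_on_def pairwise_def disjnt_def)
  then have fam_vimage: "disjoint_family_on (\<lambda>i. f -` ?B i) C"
    by (auto simp: disjoint_family_on_def vimage_Int[symmetric])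
  have "emeasure lborel U \<le> emeasure lborel (\<Union>i\<in>C. ?B i)"
  proof -
    have m: "U \<in> sets borel" "(\<Union>i\<in>C. ?B i) \<in> sets borel"
      using U by (auto intro: borel_open)
    have "U - (\<Union>i\<in>C. ?B i) \<in> null_sets lborel"
      using neg m by (simp add: negligible_iff_null_sets null_sets_completion_iff)
    then have "emeasure lborel ((\<Union>i\<in>C. ?B i) \<union> (U - (\<Union>i\<in>C. ?B i))) = emeasure lborel (\<Union>i\<in>C. ?B i)"
      using m by (intro emeasure_Un_null_set) auto
    moreover have "(\<Union>i\<in>C. ?B i) \<union> (U - (\<Union>i\<in>C. ?B i)) = U"
      using sub by auto
    ultimately show ?thesis
      by simp
  qed
  also have "\<dots> = (\<integral>\<^sup>+ i. emeasure lborel (?B i) \<partial>count_space C)"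
    using C fam by (intro emeasure_UN_countable) auto
  also have "\<dots> = (\<integral>\<^sup>+ i. emeasure lborel (f -` ?B i) \<partial>count_space C)"
    by (simp only: ball_eq)
  also have "\<dots> = emeasure lborel (\<Union>i\<in>C. f -` ?B i)"
    using C fam_vimage by (intro emeasure_UN_countable[symmetric]) auto
  also have "\<dots> \<le> emeasure lborel (f -` U)"
    using sub U contf by (intro emeasure_mono) (auto simp: open_vimage)
  finally show ?thesis .
qed

lemma borel_measurable_orthogonal_transformation:
  fixes f :: "'a::euclidean_space \<Rightarrow> 'a"
  assumes "orthogonal_transformation f"
  shows "f \<in> borel_measurable borel"
  by (intro borel_measurable_continuous_onI continuous_on_orthogonal_transformation assms)

lemma distr_lborel_orthogonal_transformation:
  fixes f :: "'a::euclidean_space \<Rightarrow> 'a"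
  assumes f: "orthogonal_transformation f"
  shows "distr lborel borel f = lborel"
proof (rule lborel_eqI[symmetric])
  fix l u :: 'a
  assume lu: "\<And>b. b \<in> Basis \<Longrightarrow> l \<bullet> b \<le> u \<bullet> b"
  have contf: "continuous_on UNIV f"
    by (rule continuous_on_orthogonal_transformation[OF f])
  have "emeasure lborel (f -` box l u) \<le> emeasure lborel (inv f -` f -` box l u)"
    using contf
    by (intro emeasure_lborel_orthogonal_vimage_ge orthogonal_transformation_inv f) (auto simp: open_vimage open_box)
  also have "inv f -` f -` box l u = box l u"
    using orthogonal_transformation_surj[OF f] by (auto simp: surj_f_inv_f)
  finally have "emeasure lborel (f -` box l u) = emeasure lborel (box l u)"
    using emeasure_lborel_orthogonal_vimage_ge[OF f open_box] by (metis antisym)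
  then show "emeasure (distr lborel borel f) (box l u) = (\<Prod>b\<in>Basis. (u - l) \<bullet> b)"
    using borel_measurable_orthogonal_transformation[OF f] lu by (simp add: emeasure_distr)
qed simp

section \<open>The standard Gaussian: rotation invariance and null sets\<close>

lemma std_gaussian_density_eq:
  fixes x :: "real ^ 'n"
  shows "(\<Prod>i\<in>UNIV. std_normal_density (x $ i)) = (1 / sqrt (2 * pi)) ^ CARD('n) * exp (- (x \<bullet> x) / 2)"
  by (simp add: std_normal_density_def prod.distrib exp_sum[symmetric] inner_vec_def sum_negf
      sum_divide_distrib power2_eq_square prod_dividef power_one_over)

lemma sets_std_gaussian [simp, measurable_cong]: "sets std_gaussian = sets borel"
  by (simp add: std_gaussian_def)

lemma space_std_gaussian [simp]: "space std_gaussian = UNIV"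
  by (simp add: std_gaussian_def)

text \<open>The density depends on \<open>x\<close> only through \<open>x \<bullet> x\<close>, which
  \<open>f\<close> preserves, and \<open>f\<close> preserves Lebesgue measure.\<close>

lemma distr_std_gaussian_orthogonal_transformation:
  fixes f :: "real ^ 'n \<Rightarrow> real ^ 'n"
  assumes f: "orthogonal_transformation f"
  shows "distr std_gaussian borel f = std_gaussian"
proof -
  note [measurable] = borel_measurable_orthogonal_transformation[OF f]
  define g :: "real ^ 'n \<Rightarrow> ennreal" where "g = (\<lambda>x. ennreal (\<Prod>i\<in>UNIV. std_normal_density (x $ i)))"
  have gf: "g (f x) = g x" for x
    using f by (simp add: g_def std_gaussian_density_eq orthogonal_transformation_def)
  have [measurable]: "g \<in> borel_measurable borel"
    unfolding g_def by measurable
  have "std_gaussian = density (distr lborel borel f) g"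
    by (simp add: std_gaussian_def g_def distr_lborel_orthogonal_transformation[OF f])
  also have "\<dots> = distr (density lborel (\<lambda>x. g (f x))) borel f"
    by (rule density_distr) auto
  also have "\<dots> = distr std_gaussian borel f"
    by (simp add: gf) (simp add: std_gaussian_def g_def)
  finally show ?thesis ..
qed

lemma prob_space_std_gaussian: "prob_space (std_gaussian :: (real ^ 'n) measure)"
proof
  \<comment> \<open>Reindexing coordinates by the basis vectors \<open>axis i 1\<close> brings the
    density into the form in which the integral factorizes.\<close>
  have inj: "inj (\<lambda>i. axis i 1 :: real ^ 'n)"
    by (simp add: inj_def axis_eq_axis)
  have Basis: "(Basis :: (real ^ 'n) set) = range (\<lambda>i. axis i 1)"
    by (auto simp: Basis_vec_def)
  have "emeasure std_gaussian (UNIV :: (real ^ 'n) set)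
      = (\<integral>\<^sup>+ x. (\<Prod>i\<in>UNIV. ennreal (std_normal_density ((x :: real ^ 'n) $ i))) \<partial>lborel)"
    by (simp add: std_gaussian_def emeasure_density prod_ennreal)
  also have "\<dots> = (\<integral>\<^sup>+ x. (\<Prod>b\<in>Basis. ennreal (std_normal_density ((x :: real ^ 'n) \<bullet> b))) \<partial>lborel)"
    unfolding Basis by (simp add: prod.reindex[OF inj] inner_axis o_def)
  also have "\<dots> = (\<Prod>b\<in>(Basis :: (real ^ 'n) set). \<integral>\<^sup>+ x. ennreal (std_normal_density x) \<partial>lborel)"
    by (rule nn_integral_lborel_prod) auto
  also have "(\<integral>\<^sup>+ x. ennreal (std_normal_density x) \<partial>lborel) = 1"
    using prob_space.emeasure_space_1[OF prob_space_normal_density[of 1 0]]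
    by (simp add: emeasure_density)
  finally show "emeasure std_gaussian (space std_gaussian :: (real ^ 'n) set) = 1"
    by simp
qed

text \<open>The density is positive everywhere, so facts about Lebesgue negligible sets carry over
  to the Gaussian.\<close>

lemma AE_std_gaussian_iff: "(AE z in std_gaussian. P z) \<longleftrightarrow> (AE z in lborel. P (z :: real ^ 'n))"
proof -
  have "(\<Prod>i\<in>UNIV. std_normal_density (z $ i)) > 0" for z :: "real ^ 'n"
    by (intro prod_pos) (auto simp: normal_density_pos)
  then show ?thesis
    unfolding std_gaussian_def by (subst AE_density) auto
qed

lemma null_sets_std_gaussian: "null_sets std_gaussian = null_sets (lborel :: (real ^ 'n) measure)"
proof (rule set_eqI)
  fix N :: "(real ^ 'n) set"
  show "N \<in> null_sets std_gaussian \<longleftrightarrow> N \<in> null_sets lborel"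
  proof (cases "N \<in> sets borel")
    case True
    then show ?thesis
      using AE_std_gaussian_iff[of "\<lambda>z. z \<notin> N"]
      by (simp add: AE_iff_null_sets[of N std_gaussian] AE_iff_null_sets[of N lborel])
  qed (auto dest: null_setsD2)
qed

lemma measure_std_gaussian_open_pos:
  fixes U :: "(real ^ 'n) set"
  assumes "open U" "U \<noteq> {}"
  shows "0 < measure std_gaussian U"
proof -
  interpret prob_space "std_gaussian :: (real ^ 'n) measure"
    by (rule prob_space_std_gaussian)
  have "U \<notin> null_sets std_gaussian"
    using open_not_negligible[OF assms] assms
    by (auto simp: null_sets_std_gaussian negligible_iff_null_sets null_sets_completionI)
  then show ?thesis
    using assms
    by (auto simp: zero_less_measure_iff emeasure_eq_measure
        intro!: null_setsI)
qed

lemma std_gaussian_hyperplane_null: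
  fixes a :: "real ^ 'n"
  assumes "a \<noteq> 0"
  shows "{z. a \<bullet> z = c} \<in> null_sets std_gaussian"
proof -
  have "{z. a \<bullet> z = c} \<in> sets borel"
    by (intro borel_closed closed_hyperplane)
  then show ?thesis
    using negligible_hyperplane[of a c] assms
    by (simp add: null_sets_std_gaussian negligible_iff_null_sets null_sets_completion_iff)
qed

section \<open>Reflections and the strict Slepian inequality\<close>

definition reflect :: "'a::euclidean_space \<Rightarrow> 'a \<Rightarrow> 'a" where
  "reflect w z = z - (2 * (w \<bullet> z) / (w \<bullet> w)) *\<^sub>R w"

lemma orthogonal_transformation_reflect: "orthogonal_transformation (reflect w)"
proof -
  have "linear (reflect w)"
    by (rule linearI)
      (simp_all add: reflect_def inner_add_right algebra_simps add_divide_distrib scaleR_add_left)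
  moreover have "reflect w x \<bullet> reflect w y = x \<bullet> y" for x y
    \<comment> \<open>Division by zero makes \<open>reflect 0\<close> the identity, so the claim
      covers \<open>w = 0\<close> as well.\<close>
    by (cases "w = 0") (simp_all add: reflect_def inner_diff_left inner_diff_right inner_commute field_simps)
  ultimately show ?thesis
    by (simp add: orthogonal_transformation_def)
qed

lemma inner_reflect: "x \<bullet> reflect w y = x \<bullet> y - 2 * (w \<bullet> y) * (x \<bullet> w) / (w \<bullet> w)"
  by (simp add: reflect_def inner_diff_right)

text \<open>These two values make the reflection along \<open>a - b\<close> exchange
  \<open>a\<close> and \<open>b\<close>.\<close>

lemma inner_diff_self_eq_norm:
  fixes a b :: "'a::real_inner"
  assumes "norm a = norm b"
  shows "a \<bullet> (a - b) = (a - b) \<bullet> (a - b) / 2" "b \<bullet> (a - b) = - ((a - b) \<bullet> (a - b) / 2)"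
proof -
  have "a \<bullet> a = b \<bullet> b"
    using assms by (simp add: norm_eq_sqrt_inner)
  then show "a \<bullet> (a - b) = (a - b) \<bullet> (a - b) / 2" "b \<bullet> (a - b) = - ((a - b) \<bullet> (a - b) / 2)"
    by (simp_all add: inner_diff_left inner_diff_right inner_commute field_simps)
qed

lemma measure_std_gaussian_orthogonal_vimage:
  fixes f :: "real ^ 'n \<Rightarrow> real ^ 'n"
  assumes f: "orthogonal_transformation f" and B: "B \<in> sets borel"
  shows "measure std_gaussian (f -` B) = measure std_gaussian B"
proof -
  have "measure std_gaussian B = measure (distr std_gaussian borel f) B"
    by (simp add: distr_std_gaussian_orthogonal_transformation[OF f])
  also have "\<dots> = measure std_gaussian (f -` B)"
    using borel_measurable_orthogonal_transformation[OF f] B by (subst measure_distr) auto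
  finally show ?thesis ..
qed

text \<open>Slepian's inequality in its strict form. The two wedges \<open>{a \<bullet> z \<ge> k > b \<bullet> z}\<close> and
  \<open>{b \<bullet> z \<ge> k > a \<bullet> z}\<close> are exchanged by the reflection in the bisecting hyperplane of \<open>a\<close> and \<open>b\<close>,
  and the half-space \<open>{e \<bullet> z \<ge> h}\<close> cuts off more of the former.\<close>

lemma std_gaussian_orthant_strict_mono:
  fixes a b e :: "real ^ 'n"
  assumes norm: "norm a = norm b" and less: "e \<bullet> b < e \<bullet> a"
  shows "measure std_gaussian {z. h \<le> e \<bullet> z \<and> k \<le> b \<bullet> z}
       < measure std_gaussian {z. h \<le> e \<bullet> z \<and> k \<le> a \<bullet> z}"
proof -
  interpret prob_space "std_gaussian :: (real ^ 'n) measure"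
    by (rule prob_space_std_gaussian)
  define w where "w = a - b"
  have ew: "e \<bullet> w > 0"
    using less by (simp add: w_def inner_diff_right)
  then have ww: "w \<bullet> w > 0"
    by (metis inner_gt_zero_iff inner_zero_right less_irrefl)
  have aw: "a \<bullet> w = w \<bullet> w / 2" and bw: "b \<bullet> w = - (w \<bullet> w / 2)"
    using inner_diff_self_eq_norm[OF norm] by (simp_all add: w_def)
  have aR: "a \<bullet> reflect w z = b \<bullet> z" and bR: "b \<bullet> reflect w z = a \<bullet> z" for z
    using ww by (simp_all add: inner_reflect aw bw) (simp_all add: w_def inner_diff_left)
  \<comment> \<open>Both orthants contain \<open>B\<close>; what remains is the wedge
    \<open>Q\<close> or the wedge \<open>Q'\<close>. The mirror image \<open>P\<close> of
    \<open>Q'\<close> lies in \<open>Q\<close>, and \<open>U\<close> is an open part of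
    \<open>Q\<close> that \<open>P\<close> misses: its points leave the half-space of
    \<open>e\<close> when reflected.\<close>
  define B where "B = {z. h \<le> e \<bullet> z \<and> k \<le> a \<bullet> z \<and> k \<le> b \<bullet> z}"
  define Q where "Q = {z. h \<le> e \<bullet> z \<and> k \<le> a \<bullet> z \<and> b \<bullet> z < k}"
  define Q' where "Q' = {z. h \<le> e \<bullet> z \<and> k \<le> b \<bullet> z \<and> a \<bullet> z < k}"
  define P where "P = reflect w -` Q'"
  define U where "U = {z. h < e \<bullet> z \<and> e \<bullet> reflect w z < h \<and> k < a \<bullet> z \<and> b \<bullet> z < k}"
  have contR: "continuous_on UNIV (\<lambda>z. e \<bullet> reflect w z)"
    by (intro continuous_intros continuous_on_orthogonal_transformation orthogonal_transformation_reflect)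
  have B [measurable]: "B \<in> sets borel" and Q [measurable]: "Q \<in> sets borel"
    and Q' [measurable]: "Q' \<in> sets borel"
    unfolding B_def Q_def Q'_def by measurable
  have P [measurable]: "P \<in> sets borel"
    unfolding P_def
    by (intro measurable_sets_borel[OF _ Q'] borel_measurable_orthogonal_transformation
        orthogonal_transformation_reflect)
  have openU: "open U"
    unfolding U_def by (intro open_Collect_conj open_Collect_less contR continuous_intros)
  have "P \<union> U \<subseteq> Q"
  proof -
    \<comment> \<open>On this side of the mirror \<open>w \<bullet> z > 0\<close>, so reflecting
      lowers \<open>e \<bullet> z\<close>.\<close>
    have "h \<le> e \<bullet> z" if "h \<le> e \<bullet> reflect w z" "k \<le> a \<bullet> z" "b \<bullet> z < k" for z
    proof -
      have "w \<bullet> z > 0"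
        using that by (simp add: w_def inner_diff_left)
      then have "2 * (w \<bullet> z) * (e \<bullet> w) / (w \<bullet> w) > 0"
        using ew ww by simp
      then show ?thesis
        using that(1) by (simp add: inner_reflect)
    qed
    then show ?thesis
      by (auto simp: P_def Q'_def Q_def U_def aR bR)
  qed
  moreover have "P \<inter> U = {}"
    by (auto simp: P_def U_def Q'_def)
  ultimately have "prob P + prob U \<le> prob Q"
    using openU by (subst finite_measure_Union[symmetric]) (auto intro!: finite_measure_mono)
  moreover have "prob P = prob Q'"
    unfolding P_def by (intro measure_std_gaussian_orthogonal_vimage orthogonal_transformation_reflect Q')
  moreover have "prob U > 0"
  proof (rule measure_std_gaussian_open_pos[OF openU])
    \<comment> \<open>The reflection negates \<open>w\<close>, so a large multiple of
      \<open>w\<close> lies in \<open>U\<close>; \<open>y\<close> is large enough for both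
      thresholds \<open>h\<close> and \<open>k\<close>.\<close>
    define y where "y = \<bar>h\<bar> / (e \<bullet> w) + \<bar>k\<bar> / (a \<bullet> w) + 1"
    have aw0: "a \<bullet> w > 0"
      using aw ww by linarith
    have "y * (e \<bullet> w) = \<bar>h\<bar> + \<bar>k\<bar> / (a \<bullet> w) * (e \<bullet> w) + e \<bullet> w"
      using ew by (simp add: y_def algebra_simps)
    then have ye: "y * (e \<bullet> w) > \<bar>h\<bar>"
      using ew aw0 by (smt (verit) divide_nonneg_pos mult_nonneg_nonneg)
    have "y * (a \<bullet> w) = \<bar>h\<bar> / (e \<bullet> w) * (a \<bullet> w) + \<bar>k\<bar> + a \<bullet> w"
      using aw0 by (simp add: y_def algebra_simps)
    then have ya: "y * (a \<bullet> w) > \<bar>k\<bar>"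
      using ew aw0 by (smt (verit) divide_nonneg_pos mult_nonneg_nonneg)
    have "e \<bullet> reflect w (y *\<^sub>R w) = - (y * (e \<bullet> w))"
      using ww by (simp add: inner_reflect)
    then have "y *\<^sub>R w \<in> U"
      using ye ya by (auto simp: U_def aw bw)
    then show "U \<noteq> {}"
      by blast
  qed
  moreover have "prob {z. h \<le> e \<bullet> z \<and> k \<le> a \<bullet> z} = prob B + prob Q"
    by (subst finite_measure_Union[symmetric]) (auto simp: B_def Q_def intro!: arg_cong[where f = prob])
  moreover have "prob {z. h \<le> e \<bullet> z \<and> k \<le> b \<bullet> z} = prob B + prob Q'"
    by (subst finite_measure_Union[symmetric]) (auto simp: B_def Q'_def intro!: arg_cong[where f = prob])
  ultimately show ?thesis
    by simp
qed

section \<open>Half-spaces and orthants determined by their probabilities\<close>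

lemma std_gaussian_half_space_strict_antimono:
  fixes a :: "real ^ 'n"
  assumes "a \<noteq> 0" "h < k"
  shows "measure std_gaussian {z. k \<le> a \<bullet> z} < measure std_gaussian {z. h \<le> a \<bullet> z}"
proof -
  interpret prob_space "std_gaussian :: (real ^ 'n) measure"
    by (rule prob_space_std_gaussian)
  define U where "U = {z. h < a \<bullet> z \<and> a \<bullet> z < k}"
  have openU: "open U"
    unfolding U_def by (intro open_Collect_conj open_Collect_less continuous_intros)
  \<comment> \<open>The multiple of \<open>a\<close> midway between the two bounding
    hyperplanes.\<close>
  have "((h + k) / 2 / (a \<bullet> a)) *\<^sub>R a \<in> U"
    using assms by (simp add: U_def)
  then have "prob U > 0"
    using measure_std_gaussian_open_pos[OF openU] by blast
  moreover have "prob {z. k \<le> a \<bullet> z} + prob U \<le> prob {z. h \<le> a \<bullet> z}"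
    using openU assms
    by (subst finite_measure_Union[symmetric]) (auto simp: U_def intro!: finite_measure_mono)
  ultimately show ?thesis
    by simp
qed

lemma le_inner_iff_sgn:
  fixes a z :: "'a::real_inner"
  assumes "a \<noteq> 0"
  shows "s \<le> a \<bullet> z \<longleftrightarrow> s / norm a \<le> sgn a \<bullet> z"
  using assms by (simp add: sgn_div_norm field_simps)

text \<open>A rotation taking \<open>sgn a'\<close> to \<open>sgn a\<close> makes the half-spaces
  parallel, and then strict monotonicity in the threshold decides.\<close>

lemma std_gaussian_half_space_identifies:
  fixes a a' :: "real ^ 'n"
  assumes a: "a \<noteq> 0" "a' \<noteq> 0"
    and eq: "measure std_gaussian {z. s \<le> a \<bullet> z} = measure std_gaussian {z. s' \<le> a' \<bullet> z}"
  shows "s / norm a = s' / norm a'"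
proof -
  have "norm (sgn a') = norm (sgn a)"
    using a by (simp add: norm_sgn)
  then obtain f where f: "orthogonal_transformation f" "f (sgn a') = sgn a"
    by (rule orthogonal_transformation_exists)
  have "measure std_gaussian {z. s' / norm a' \<le> sgn a \<bullet> z}
      = measure std_gaussian (f -` {z. s' / norm a' \<le> sgn a \<bullet> z})"
    by (intro measure_std_gaussian_orthogonal_vimage[symmetric] f) measurable
  also have "f -` {z. s' / norm a' \<le> sgn a \<bullet> z} = {z. s' / norm a' \<le> sgn a' \<bullet> z}"
    using f by (auto simp: orthogonal_transformation_def f(2)[symmetric])
  finally have "measure std_gaussian {z. s / norm a \<le> sgn a \<bullet> z}
      = measure std_gaussian {z. s' / norm a' \<le> sgn a \<bullet> z}"
    using eq a by (simp add: le_inner_iff_sgn)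
  then show ?thesis
    using std_gaussian_half_space_strict_antimono[of "sgn a"] a
    by (metis linorder_neqE_linordered_idom order_less_irrefl sgn_zero_iff)
qed

text \<open>After a rotation aligning the first normals, the orthants have equal thresholds and
  differ only in the second unit normal, \<open>sgn b\<close> or \<open>c\<close>. Strict Slepian
  rules out either inner product with \<open>sgn a\<close> being larger.\<close>

lemma std_gaussian_orthant_identifies:
  fixes a a' b b' :: "real ^ 'n"
  assumes nz: "a \<noteq> 0" "a' \<noteq> 0" "b \<noteq> 0" "b' \<noteq> 0"
    and s: "s / norm a = s' / norm a'" and t: "t / norm b = t' / norm b'"
    and eq: "measure std_gaussian {z. s \<le> a \<bullet> z \<and> t \<le> b \<bullet> z}
           = measure std_gaussian {z. s' \<le> a' \<bullet> z \<and> t' \<le> b' \<bullet> z}"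
  shows "sgn a \<bullet> sgn b = sgn a' \<bullet> sgn b'"
proof -
  have "norm (sgn a') = norm (sgn a)"
    using nz by (simp add: norm_sgn)
  then obtain f where f: "orthogonal_transformation f" "f (sgn a') = sgn a"
    by (rule orthogonal_transformation_exists)
  define h k where "h = s / norm a" and "k = t / norm b"
  define c where "c = f (sgn b')"
  have inner_c: "sgn a \<bullet> c = sgn a' \<bullet> sgn b'"
    using f by (simp add: c_def orthogonal_transformation_def f(2)[symmetric])
  have norm_c: "norm c = norm (sgn b)"
    using f nz by (simp add: c_def orthogonal_transformation_norm norm_sgn)
  have "measure std_gaussian {z. h \<le> sgn a \<bullet> z \<and> k \<le> c \<bullet> z}
      = measure std_gaussian (f -` {z. h \<le> sgn a \<bullet> z \<and> k \<le> c \<bullet> z})"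
    by (intro measure_std_gaussian_orthogonal_vimage[symmetric] f) measurable
  also have "f -` {z. h \<le> sgn a \<bullet> z \<and> k \<le> c \<bullet> z} = {z. h \<le> sgn a' \<bullet> z \<and> k \<le> sgn b' \<bullet> z}"
    using f by (auto simp: orthogonal_transformation_def f(2)[symmetric] c_def)
  also have "measure std_gaussian \<dots> = measure std_gaussian {z. h \<le> sgn a \<bullet> z \<and> k \<le> sgn b \<bullet> z}"
    using eq nz by (simp add: le_inner_iff_sgn h_def k_def s t)
  finally have "\<not> sgn a \<bullet> c < sgn a \<bullet> sgn b" "\<not> sgn a \<bullet> sgn b < sgn a \<bullet> c"
    using std_gaussian_orthant_strict_mono[of "sgn b" c "sgn a" h k]
      std_gaussian_orthant_strict_mono[of c "sgn b" "sgn a" h k] norm_c by auto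
  then show ?thesis
    using inner_c by simp
qed

section \<open>Similar triangles\<close>

text \<open>The closing relation of the first triangle is a vanishing combination of its unit edge
  vectors, with the side lengths as coefficients. The squared norm of such a combination involves
  only inner products of these vectors, so the same coefficients annihilate the unit edges of the
  second triangle; independence then compares coefficients.\<close>

lemma triangle_sides_proportional:
  fixes p q p' q' :: "'a::real_inner"
  assumes nz: "p \<noteq> 0" "q \<noteq> 0" "p + q \<noteq> 0"
    and indep: "\<And>\<alpha> \<beta>. \<alpha> *\<^sub>R p' + \<beta> *\<^sub>R q' = 0 \<Longrightarrow> \<alpha> = 0 \<and> \<beta> = 0"
    and pq: "sgn p \<bullet> sgn q = sgn p' \<bullet> sgn q'"
    and pr: "sgn p \<bullet> sgn (p + q) = sgn p' \<bullet> sgn (p' + q')"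
    and qr: "sgn q \<bullet> sgn (p + q) = sgn q' \<bullet> sgn (p' + q')"
  shows "norm p' / norm p = norm q' / norm q"
proof -
  have nz': "p' \<noteq> 0" "q' \<noteq> 0" "p' + q' \<noteq> 0"
    using indep[of 1 0] indep[of 0 1] indep[of 1 1] by auto
  define P Q R where "P = norm p" and "Q = norm q" and "R = norm (p + q)"
  have unit: "sgn x \<bullet> sgn x = 1" if "x \<noteq> 0" for x :: 'a
    using that by (simp add: dot_square_norm norm_sgn)
  have expand: "(P *\<^sub>R x + Q *\<^sub>R y - R *\<^sub>R z) \<bullet> (P *\<^sub>R x + Q *\<^sub>R y - R *\<^sub>R z)
      = P\<^sup>2 * (x \<bullet> x) + Q\<^sup>2 * (y \<bullet> y) + R\<^sup>2 * (z \<bullet> z)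
        + 2 * P * Q * (x \<bullet> y) - 2 * P * R * (x \<bullet> z) - 2 * Q * R * (y \<bullet> z)" for x y z :: 'a
    by (simp add: inner_add_left inner_add_right inner_diff_left inner_diff_right inner_commute
        power2_eq_square algebra_simps)
  have "P *\<^sub>R sgn p + Q *\<^sub>R sgn q - R *\<^sub>R sgn (p + q) = 0"
    using nz by (simp add: P_def Q_def R_def sgn_div_norm)
  then have "P *\<^sub>R sgn p' + Q *\<^sub>R sgn q' - R *\<^sub>R sgn (p' + q') = 0"
    using expand[of "sgn p" "sgn q" "sgn (p + q)"] expand[of "sgn p'" "sgn q'" "sgn (p' + q')"]
    by (simp add: unit nz nz' pq pr qr)
  then have "(P / norm p' - R / norm (p' + q')) *\<^sub>R p' + (Q / norm q' - R / norm (p' + q')) *\<^sub>R q' = 0"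
    by (simp add: sgn_div_norm algebra_simps divide_inverse)
  then have "P / norm p' = Q / norm q'"
    using indep by fastforce
  then show ?thesis
    using nz nz' by (simp add: P_def Q_def field_simps)
qed

section \<open>Consequences of the rank condition\<close>

text \<open>By symmetry the range of \<open>S\<close> is orthogonal to its kernel. A nonzero
  \<open>x\<close> would add a second kernel direction next to the all-ones vector, and the
  dimensions would sum to more than \<open>CARD('n)\<close>.\<close>

lemma null_space_of_probit_normalized:
  fixes S :: "real ^ 'n ^ 'n"
  assumes S: "probit_normalized mu S" and x: "S *v x = 0" "x \<bullet> (\<chi> i. 1) = 0"
  shows "x = 0"
proof (rule ccontr)
  assume "x \<noteq> 0"
  let ?one = "(\<chi> i. 1) :: real ^ 'n"
  have one0: "?one \<noteq> 0"
    by (simp add: vec_eq_iff)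
  have "x \<noteq> ?one"
    using x \<open>x \<noteq> 0\<close> by auto
  have ind: "independent {x, ?one}"
    using \<open>x \<noteq> 0\<close> one0 x
    by (intro pairwise_orthogonal_independent) (auto simp: pairwise_def orthogonal_def inner_commute)
  have tr: "transpose S = S" and rk: "rank S = CARD('n) - 1" and S1: "S *v ?one = 0"
    using S by (auto simp: probit_normalized_def)
  have "(S *v v) \<bullet> u = v \<bullet> (S *v u)" for u v
    using tr by (metis dot_lmul_matrix inner_commute transpose_matrix_vector)
  then have "dim (range (\<lambda>v. S *v v) \<union> {x, ?one}) = dim (range (\<lambda>v. S *v v)) + dim {x, ?one}"
    using x S1 by (intro dim_orthogonal_sum) auto
  also have "dim {x, ?one} = 2"
    using ind \<open>x \<noteq> ?one\<close> by (simp add: dim_eq_card_independent)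
  finally have "CARD('n) - 1 + 2 \<le> CARD('n)"
    using dim_subset_UNIV[of "range (\<lambda>v. S *v v) \<union> {x, ?one}"] rk
    by (simp add: rank_dim_range)
  then show False
    by simp
qed

text \<open>The combination of rows is \<open>transpose A *v x\<close> for a coefficient vector
  \<open>x\<close> with entries summing to zero. If it vanishes, so does \<open>S *v x\<close>,
  hence \<open>x\<close>.\<close>

lemma affine_independent_rows:
  fixes A S :: "real ^ 'n ^ 'n"
  assumes S: "probit_normalized mu S" and A: "A ** transpose A = S"
    and ijk: "i \<noteq> j" "j \<noteq> k" "i \<noteq> k"
    and zero: "\<alpha> *\<^sub>R (A $ i - A $ j) + \<beta> *\<^sub>R (A $ j - A $ k) = 0"
  shows "\<alpha> = 0 \<and> \<beta> = 0"
proof -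
  define x where "x = \<alpha> *\<^sub>R (axis i 1 - axis j 1) + \<beta> *\<^sub>R (axis j 1 - axis k 1 :: real ^ 'n)"
  have axis: "transpose A *v axis l 1 = A $ l" for l
    by (simp add: matrix_vector_mult_basis column_transpose row_def vec_nth_inverse)
  have "transpose A *v x = \<alpha> *\<^sub>R (A $ i - A $ j) + \<beta> *\<^sub>R (A $ j - A $ k)"
    by (simp add: x_def matrix_vector_right_distrib matrix_vector_mult_scaleR axis
        matrix_vector_mult_diff_distrib del: transpose_matrix_vector)
  then have "S *v x = 0"
    using zero by (simp add: A[symmetric] matrix_vector_mul_assoc[symmetric] del: transpose_matrix_vector)
  moreover have "x \<bullet> (\<chi> i. 1) = 0"
    by (simp add: x_def inner_add_left inner_diff_left inner_axis')
  ultimately have "x = 0"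
    by (rule null_space_of_probit_normalized[OF S])
  \<comment> \<open>These coordinates of \<open>x\<close> are \<alpha> and -\<beta>.\<close>
  then have "x $ i = 0" "x $ k = 0"
    by simp_all
  then show ?thesis
    using ijk by (simp add: x_def axis_def)
qed

section \<open>Order events of a Gaussian vector\<close>

text \<open>The three terms place \<open>k\<close> below, between or above \<open>j\<close> and
  \<open>i\<close>; their overlaps consist of ties, which are null.\<close>

lemma prob_pair_eq_sum_triples:
  fixes M :: "(real ^ 'n) measure"
  assumes "prob_space M" and [measurable_cong]: "sets M = sets borel"
    and jk: "AE x in M. x $ j \<noteq> x $ k" and ik: "AE x in M. x $ i \<noteq> x $ k"
  shows "measure M {x. x $ i \<ge> x $ j}
       = measure M {x. x $ i \<ge> x $ j \<and> x $ j \<ge> x $ k}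
       + measure M {x. x $ i \<ge> x $ k \<and> x $ k \<ge> x $ j}
       + measure M {x. x $ k \<ge> x $ i \<and> x $ i \<ge> x $ j}"
proof -
  interpret prob_space M by fact
  \<comment> \<open>Strict inequalities in \<open>B2\<close> and \<open>B3\<close> make the pieces
    disjoint while still covering the event.\<close>
  define B1 B2 B3 where "B1 = {x :: real ^ 'n. x $ i \<ge> x $ j \<and> x $ j \<ge> x $ k}"
    and "B2 = {x :: real ^ 'n. x $ i \<ge> x $ k \<and> x $ k > x $ j}"
    and "B3 = {x :: real ^ 'n. x $ k > x $ i \<and> x $ i \<ge> x $ j}"
  have [measurable]: "B1 \<in> sets M" "B2 \<in> sets M" "B3 \<in> sets M"
    unfolding B1_def B2_def B3_def assms(2) by measurable
  have "prob {x. x $ i \<ge> x $ j} = prob (B1 \<union> B2 \<union> B3)"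
    by (rule arg_cong[where f = prob]) (auto simp: B1_def B2_def B3_def)
  also have "\<dots> = prob (B1 \<union> B2) + prob B3"
    by (rule finite_measure_Union) (auto simp: B1_def B2_def B3_def)
  also have "prob (B1 \<union> B2) = prob B1 + prob B2"
    by (rule finite_measure_Union) (auto simp: B1_def B2_def)
  also have "prob B2 = prob {x. x $ i \<ge> x $ k \<and> x $ k \<ge> x $ j}"
  proof (rule finite_measure_eq_AE)
    show "AE x in M. (x \<in> B2) = (x \<in> {x. x $ i \<ge> x $ k \<and> x $ k \<ge> x $ j})"
      using jk by eventually_elim (auto simp: B2_def)
    show "{x. x $ i \<ge> x $ k \<and> x $ k \<ge> x $ j} \<in> sets M"
      unfolding assms(2) by measurable
  qed simp
  also have "prob B3 = prob {x. x $ k \<ge> x $ i \<and> x $ i \<ge> x $ j}"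
  proof (rule finite_measure_eq_AE)
    show "AE x in M. (x \<in> B3) = (x \<in> {x. x $ k \<ge> x $ i \<and> x $ i \<ge> x $ j})"
      using ik by eventually_elim (auto simp: B3_def)
    show "{x. x $ k \<ge> x $ i \<and> x $ i \<ge> x $ j} \<in> sets M"
      unfolding assms(2) by measurable
  qed simp
  finally show ?thesis
    by (simp add: B1_def)
qed

lemma borel_measurable_affine_vec:
  fixes A :: "real ^ 'n ^ 'm"
  shows "(\<lambda>z. mu + A *v z) \<in> borel_measurable borel"
  by (intro borel_measurable_continuous_onI continuous_intros matrix_vector_mult_linear_continuous_on)

text \<open>Coordinate \<open>i\<close> of the vector is \<open>mu $ i + A $ i \<bullet> z\<close>,
  so each comparison of coordinates is a half-space condition on \<open>z\<close> with a difference
  of rows as normal.\<close>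

lemma gaussian_law_affine_image:
  fixes mu :: "real ^ 'n" and A :: "real ^ 'n ^ 'n"
  defines "M \<equiv> distr std_gaussian borel (\<lambda>z. mu + A *v z)"
  shows "prob_space M"
    and "measure M {x. x $ i \<ge> x $ j} = measure std_gaussian {z. mu $ j - mu $ i \<le> (A $ i - A $ j) \<bullet> z}"
    and "measure M {x. x $ i \<ge> x $ j \<and> x $ j \<ge> x $ k}
       = measure std_gaussian {z. mu $ j - mu $ i \<le> (A $ i - A $ j) \<bullet> z \<and>
           mu $ k - mu $ j \<le> (A $ j - A $ k) \<bullet> z}"
    and "A $ i \<noteq> A $ j \<Longrightarrow> AE x in M. x $ i \<noteq> x $ j"
proof -
  note [measurable] = borel_measurable_affine_vec[of mu A]
  show "prob_space M"
    unfolding M_def by (intro prob_space.prob_space_distr prob_space_std_gaussian) measurable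
  have comp: "(mu + A *v z) $ l = mu $ l + A $ l \<bullet> z" for z l
    by (simp add: matrix_vector_mul_component)
  have "measure M {x. x $ i \<ge> x $ j}
      = measure std_gaussian ((\<lambda>z. mu + A *v z) -` {x. x $ i \<ge> x $ j} \<inter> space std_gaussian)"
    unfolding M_def by (rule measure_distr) measurable
  then show "measure M {x. x $ i \<ge> x $ j} = measure std_gaussian {z. mu $ j - mu $ i \<le> (A $ i - A $ j) \<bullet> z}"
    by (simp add: vimage_def comp inner_diff_left algebra_simps del: vector_add_component)
  have "measure M {x. x $ i \<ge> x $ j \<and> x $ j \<ge> x $ k}
      = measure std_gaussian ((\<lambda>z. mu + A *v z) -` {x. x $ i \<ge> x $ j \<and> x $ j \<ge> x $ k} \<inter> space std_gaussian)"
    unfolding M_def by (rule measure_distr) measurable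
  then show "measure M {x. x $ i \<ge> x $ j \<and> x $ j \<ge> x $ k}
       = measure std_gaussian {z. mu $ j - mu $ i \<le> (A $ i - A $ j) \<bullet> z \<and>
           mu $ k - mu $ j \<le> (A $ j - A $ k) \<bullet> z}"
    by (simp add: vimage_def comp inner_diff_left algebra_simps del: vector_add_component)
  assume "A $ i \<noteq> A $ j"
  then have "{z. (A $ i - A $ j) \<bullet> z = mu $ j - mu $ i} \<in> null_sets std_gaussian"
    by (intro std_gaussian_hyperplane_null) simp
  then have "AE z in std_gaussian. z \<notin> {z. (A $ i - A $ j) \<bullet> z = mu $ j - mu $ i}"
    by (rule AE_not_in)
  then have "AE z in std_gaussian. (mu + A *v z) $ i \<noteq> (mu + A *v z) $ j"
    by eventually_elim (auto simp: comp inner_diff_left algebra_simps simp del: vector_add_component)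
  then show "AE x in M. x $ i \<noteq> x $ j"
    unfolding M_def by (subst AE_distr_iff) measurable
qed

section \<open>Linking edges through triangles\<close>

lemma exists_third_index:
  assumes "CARD('n::finite) \<ge> 3"
  obtains k where "k \<noteq> i" "k \<noteq> (j :: 'n)"
proof -
  have "card {i, j} < CARD('n)"
    using assms card_insert_le_m1[of 2 "{j}" i] by (simp add: card_insert_if)
  then have "{i, j} \<noteq> UNIV"
    by auto
  then show ?thesis
    using that by auto
qed

text \<open>Edges sharing a vertex have equal values; an edge avoiding \<open>i0\<close> is joined
  to the edge from \<open>i0\<close> to \<open>j0\<close> through the edge from \<open>i0\<close> to
  \<open>i\<close>.\<close>

lemma pairwise_constant_from_triples:
  fixes r :: "'n::finite \<Rightarrow> 'n \<Rightarrow> 'b"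
  assumes card: "CARD('n) \<ge> 3" and sym: "\<And>i j. r i j = r j i"
    and step: "\<And>i j k. i \<noteq> j \<Longrightarrow> j \<noteq> k \<Longrightarrow> i \<noteq> k \<Longrightarrow> r i j = r j k"
  shows "\<exists>c. \<forall>i j. i \<noteq> j \<longrightarrow> r i j = c"
proof -
  obtain i0 j0 :: 'n where ij0: "i0 \<noteq> j0"
    using exists_third_index[OF card] by metis
  have "r i j = r i0 j0" if "i \<noteq> j" for i j
  proof (cases "i = i0 \<or> j = i0")
    case True
    then show ?thesis
      using that ij0 sym step by (cases "i = j0 \<or> j = j0") (metis sym, metis sym step)
  next
    case False
    then have "r i j = r i0 i"
      using that step[of j i i0] sym by simp
    also have "\<dots> = r i0 j0"
      using False ij0 step[of i i0 j0] sym by (cases "i = j0") auto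
    finally show ?thesis .
  qed
  then show ?thesis
    by blast
qed

section \<open>From distances to the covariance\<close>

text \<open>Rows sum to zero and the trace is fixed, so summing squared distances over
  \<open>j\<close> isolates the diagonal entry, and summing again leaves a positive constant. The
  totals give \<open>c = 1\<close>, the row sums the diagonal, and the distances the remaining
  entries.\<close>

lemma covariance_eq_of_proportional_distances:
  fixes S T :: "real ^ 'n ^ 'n"
  assumes S: "probit_normalized mu S" and T: "probit_normalized nu T"
    and proportional: "\<And>i j. T $ i $ i + T $ j $ j - 2 * T $ i $ j = c * (S $ i $ i + S $ j $ j - 2 * S $ i $ j)"
  shows "c = 1" "S = T"
proof -
  let ?n = "real CARD('n)"
  have row_sum: "(\<Sum>j\<in>UNIV. V $ i $ i + V $ j $ j - 2 * V $ i $ j) = ?n * V $ i $ i + ?n"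
    and total: "(\<Sum>i\<in>UNIV. ?n * V $ i $ i + ?n) = 2 * ?n * ?n"
    if V: "probit_normalized \<kappa> V" for V :: "real ^ 'n ^ 'n" and \<kappa> i
  proof -
    have tr: "(\<Sum>j\<in>UNIV. V $ j $ j) = ?n"
      using V by (simp add: probit_normalized_def trace_def)
    have "(V *v (\<chi> i. 1)) $ i = 0"
      using V by (simp add: probit_normalized_def)
    then have "(\<Sum>j\<in>UNIV. V $ i $ j) = 0"
      by (simp add: matrix_vector_mult_def)
    then show "(\<Sum>j\<in>UNIV. V $ i $ i + V $ j $ j - 2 * V $ i $ j) = ?n * V $ i $ i + ?n"
      by (simp add: sum.distrib sum_subtractf sum_distrib_left[symmetric] tr)
    show "(\<Sum>i\<in>UNIV. ?n * V $ i $ i + ?n) = 2 * ?n * ?n"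
      by (simp add: sum.distrib sum_distrib_left[symmetric] tr)
  qed
  have diag: "?n * T $ i $ i + ?n = c * (?n * S $ i $ i + ?n)" for i
    unfolding row_sum[OF S, symmetric] row_sum[OF T, symmetric] by (simp add: proportional sum_distrib_left)
  have "2 * ?n * ?n = c * (2 * ?n * ?n)"
    unfolding total[OF S, symmetric] sum_distrib_left diag[symmetric]
    by (simp only: total[OF S] total[OF T])
  then show c: "c = 1"
    by simp
  have "T $ i $ i = S $ i $ i" for i
    using diag[of i] c by simp
  then show "S = T"
    using proportional c by (simp add: vec_eq_iff)
qed

section \<open>Identifiability\<close>

theorem theorem3:
  fixes mu mu2 :: "real ^ 'n" and S S2 :: "real ^ 'n ^ 'n"
    and M M2 :: "(real ^ 'n) measure"
  assumes "CARD('n) \<ge> 3"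
    and "probit_normalized mu S" and "probit_normalized mu2 S2"
    and "is_gaussian_law M mu S" and "is_gaussian_law M2 mu2 S2"
    and "\<And>i j k. i \<noteq> j \<Longrightarrow> j \<noteq> k \<Longrightarrow> i \<noteq> k \<Longrightarrow>
           measure M {x. x $ i \<ge> x $ j \<and> x $ j \<ge> x $ k}
         = measure M2 {x. x $ i \<ge> x $ j \<and> x $ j \<ge> x $ k}"
  shows "mu = mu2 \<and> S = S2"
proof -
  note card = assms(1) and norm1 = assms(2) and norm2 = assms(3) and triples = assms(6)
  obtain A :: "real ^ 'n ^ 'n"
    where A: "A ** transpose A = S" and M: "M = distr std_gaussian borel (\<lambda>z. mu + A *v z)"
    using assms(4) unfolding is_gaussian_law_def by blast
  obtain B :: "real ^ 'n ^ 'n"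
    where B: "B ** transpose B = S2" and M2: "M2 = distr std_gaussian borel (\<lambda>z. mu2 + B *v z)"
    using assms(5) unfolding is_gaussian_law_def by blast
  note law1 = gaussian_law_affine_image[where mu = mu and A = A, folded M]
  note law2 = gaussian_law_affine_image[where mu = mu2 and A = B, folded M2]
  note indep1 = affine_independent_rows[OF norm1 A] and indep2 = affine_independent_rows[OF norm2 B]
  have Aneq: "A $ i \<noteq> A $ j" and Bneq: "B $ i \<noteq> B $ j" if "i \<noteq> j" for i j
  proof -
    obtain k where "k \<noteq> i" "k \<noteq> j"
      using exists_third_index[OF card] .
    then show "A $ i \<noteq> A $ j" "B $ i \<noteq> B $ j"
      \<comment> \<open>Equal rows would be a vanishing combination with coefficients 1 and
        0.\<close>
      using indep1[of i j k 1 0] indep2[of i j k 1 0] that by auto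
  qed
  have standardized_means:
    "(mu $ j - mu $ i) / norm (A $ i - A $ j) = (mu2 $ j - mu2 $ i) / norm (B $ i - B $ j)"
    if ij: "i \<noteq> j" for i j
  proof -
    obtain k where k: "k \<noteq> i" "k \<noteq> j"
      using exists_third_index[OF card] .
    have "measure M {x. x $ i \<ge> x $ j}
       = measure M {x. x $ i \<ge> x $ j \<and> x $ j \<ge> x $ k}
       + measure M {x. x $ i \<ge> x $ k \<and> x $ k \<ge> x $ j}
       + measure M {x. x $ k \<ge> x $ i \<and> x $ i \<ge> x $ j}"
      using k by (intro prob_pair_eq_sum_triples law1 Aneq) (auto simp: M)
    moreover have "measure M2 {x. x $ i \<ge> x $ j}
       = measure M2 {x. x $ i \<ge> x $ j \<and> x $ j \<ge> x $ k}
       + measure M2 {x. x $ i \<ge> x $ k \<and> x $ k \<ge> x $ j}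
       + measure M2 {x. x $ k \<ge> x $ i \<and> x $ i \<ge> x $ j}"
      using k by (intro prob_pair_eq_sum_triples law2 Bneq) (auto simp: M2)
    moreover note triples[of i j k] triples[of i k j] triples[of k i j]
    ultimately have "measure M {x. x $ i \<ge> x $ j} = measure M2 {x. x $ i \<ge> x $ j}"
      using ij k by simp
    then show ?thesis
      using Aneq[OF ij] Bneq[OF ij]
      by (intro std_gaussian_half_space_identifies) (simp_all add: law1 law2)
  qed
  have correlations:
    "sgn (A $ i - A $ j) \<bullet> sgn (A $ j - A $ k) = sgn (B $ i - B $ j) \<bullet> sgn (B $ j - B $ k)"
    if "i \<noteq> j" "j \<noteq> k" "i \<noteq> k" for i j k
    using triples[OF that] that
    by (intro std_gaussian_orthant_identifies[OF _ _ _ _ standardized_means standardized_means])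
      (simp_all add: Aneq Bneq law1 law2)
  \<comment> \<open>The similarity ratio of an edge; \<open>r i i\<close> is 0 / 0 = 0, so constancy
    is claimed for distinct indices only.\<close>
  define r where "r i j = norm (B $ i - B $ j) / norm (A $ i - A $ j)" for i j
  have r_step: "r i j = r j k" if ijk: "i \<noteq> j" "j \<noteq> k" "i \<noteq> k" for i j k
    unfolding r_def
  proof (rule triangle_sides_proportional)
    \<comment> \<open>The edges add up to \<open>A $ i - A $ k\<close>. The two remaining inner
      products come from the correlations with \<open>i\<close> or \<open>k\<close> as middle index,
      after reversing one edge.\<close>
    have neg: "sgn (x - y) = - sgn (y - x)" for x y :: "real ^ 'n"
      by (metis minus_diff_eq sgn_minus)
    show "\<And>\<alpha> \<beta>. \<alpha> *\<^sub>R (B $ i - B $ j) + \<beta> *\<^sub>R (B $ j - B $ k) = 0 \<Longrightarrow> \<alpha> = 0 \<and> \<beta> = 0"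
      by (rule indep2[OF ijk])
    show "sgn (A $ i - A $ j) \<bullet> sgn (A $ i - A $ j + (A $ j - A $ k))
        = sgn (B $ i - B $ j) \<bullet> sgn (B $ i - B $ j + (B $ j - B $ k))"
      using correlations[of j i k] ijk neg[of "A $ j" "A $ i"] neg[of "B $ j" "B $ i"] by simp
    show "sgn (A $ j - A $ k) \<bullet> sgn (A $ i - A $ j + (A $ j - A $ k))
        = sgn (B $ j - B $ k) \<bullet> sgn (B $ i - B $ j + (B $ j - B $ k))"
      using correlations[of i k j] ijk neg[of "A $ k" "A $ j"] neg[of "B $ k" "B $ j"]
      by (simp add: inner_commute)
  qed (use ijk in \<open>simp_all add: Aneq correlations\<close>)
  have r_sym: "r i j = r j i" for i j
    by (simp add: r_def norm_minus_commute)
  have "\<exists>c. \<forall>i j. i \<noteq> j \<longrightarrow> r i j = c"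
    by (rule pairwise_constant_from_triples[OF card r_sym r_step])
  then obtain c where c: "r i j = c" if "i \<noteq> j" for i j
    by blast
  have norm_eq: "norm (B $ i - B $ j) = c * norm (A $ i - A $ j)" for i j
    using c[of i j] Aneq[of i j] by (cases "i = j") (auto simp: r_def field_simps)
  have dist: "V $ i $ i + V $ j $ j - 2 * V $ i $ j = (norm (C $ i - C $ j))\<^sup>2"
    if "C ** transpose C = V" for C V :: "real ^ 'n ^ 'n" and i j
  proof -
    have "V $ k $ l = C $ k \<bullet> C $ l" for k l
      by (simp add: that[symmetric] matrix_matrix_mult_def transpose_def inner_vec_def)
    then show ?thesis
      by (simp add: power2_norm_eq_inner inner_diff_left inner_diff_right inner_commute)
  qed
  have "S2 $ i $ i + S2 $ j $ j - 2 * S2 $ i $ j = c\<^sup>2 * (S $ i $ i + S $ j $ j - 2 * S $ i $ j)" for i j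
    by (simp only: dist[OF A] dist[OF B] norm_eq power_mult_distrib)
  note cov = covariance_eq_of_proportional_distances[OF norm1 norm2 this]
  have "norm (B $ i - B $ j) = norm (A $ i - A $ j)" for i j
  proof -
    \<comment> \<open>The covariance lemma was applied with factor \<open>c\<^sup>2\<close>, so it
      yields \<open>c\<^sup>2 = 1\<close>; comparing squares of norms settles the rest.\<close>
    have "(norm (B $ i - B $ j))\<^sup>2 = (norm (A $ i - A $ j))\<^sup>2"
      by (simp add: norm_eq power_mult_distrib cov(1))
    then show ?thesis
      by simp
  qed
  then have "mu $ j - mu $ i = mu2 $ j - mu2 $ i" for i j
    using standardized_means[of i j] Aneq[of i j] by (cases "i = j") auto
  then have const: "(mu - mu2) $ j = (mu - mu2) $ i" for i j
    by (simp add: algebra_simps)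
  \<comment> \<open>\<open>mu - mu2\<close> is a constant vector orthogonal to the all-ones vector,
    hence zero.\<close>
  have "real CARD('n) * (mu - mu2) $ i = 0" for i
  proof -
    have "real CARD('n) * (mu - mu2) $ i = (\<Sum>j\<in>(UNIV :: 'n set). (mu - mu2) $ i)"
      by simp
    also have "\<dots> = (\<Sum>j\<in>UNIV. (mu - mu2) $ j)"
      by (intro sum.cong refl const)
    also have "\<dots> = 0"
      using norm1 norm2 by (simp add: probit_normalized_def inner_vec_def sum_subtractf)
    finally show ?thesis .
  qed
  then have "mu = mu2"
    by (simp add: vec_eq_iff)
  then show ?thesis
    using cov(2) by simp
qed

end
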